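(* Let $\Gamma\subset\mathbb{R}^n$ be the attractor of an iterated function system $\{s_1,\dots,s_M\}$ of contracting similarities satisfying the open set condition, and let $\mu$ be an invariant measure on $\Gamma$ with weights $(p_1,\dots,p_M)$. Fix $m\in\{1,\dots,M\}$ and let $\eta_m\in\Gamma$ be the fixed point of $s_m$, i.e. the unique point such that $s_m(\eta_m)=\eta_m$. Suppose that $\eta_m\notin\Gamma_{m'}:=s_{m'}(\Gamma)$ for every $m'\in\{1,\dots,M\}$ with $m'\ne m$. Let $t_m:=\log p_m/\log\rho_m$. Then the singular integral $I_\Gamma[\Phi_t(\cdot,\eta_m)]=\int_\Gamma\Phi_t(x,\eta_m)\,d\mu(x)$ is finite for $0\le t<t_m$, and it can be represented in terms of regular integrals as $$I_\Gamma[\Phi_t(\cdot,\eta_m)]=\begin{cases}(1-p_m)^{-1}\Big(p_m\,\mu(\Gamma)\log\rho_m+\sum_{m'=1,\,m'\ne m}^MI_{\Gamma_{m'}}[\Phi_t(\cdot,\eta_m)]\Big),&t=0,\\[2mm](1-p_m\rho_m^{-t})^{-1}\sum_{m'=1,\,m'\ne m}^MI_{\Gamma_{m'}}[\Phi_t(\cdot,\eta_m)],&t\in(0,t_m),\end{cases}$$ where $I_{\Gamma_{m'}}[f]:=\int_{\Gamma_{m'}}f\,d\mu$.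
   Context: IFS: a collection $\{s_1,\dots,s_M\}$, $M\ge2$, of maps $s_m:\mathbb{R}^n\to\mathbb{R}^n$, $s_m(x)=\rho_mA_mx+\delta_m$, with $\rho_m\in(0,1)$, $A_m$ an orthogonal $n\times n$ matrix, $\delta_m\in\mathbb{R}^n$. Its attractor $\Gamma$ is the unique non-empty compact set with $\Gamma=\bigcup_{m=1}^Ms_m(\Gamma)$. Open set condition: there is a non-empty bounded open set $O\subset\mathbb{R}^n$ with $\bigcup_ms_m(O)\subset O$ and $s_m(O)\cap s_{m'}(O)=\emptyset$ for $m\ne m'$. Invariant measure with weights $(p_1,\dots,p_M)$, where $p_m\in(0,1)$ and $\sum_mp_m=1$: a non-zero finite Borel regular measure $\mu$ supported on $\Gamma$ such that $\mu(A)=\sum_{m=1}^Mp_m\mu(s_m^{-1}(A))$ for every measurable $A\subset\mathbb{R}^n$ (unique up to normalisation). For $t\ge0$ and $x\ne y$: $\Phi_0(x,y):=\log|x-y|$ and $\Phi_t(x,y):=|x-y|^{-t}$ for $t>0$. *)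

theory Defs
  imports "HOL-Analysis.Analysis"
begin

definition ifs_map ::
  "(nat \<Rightarrow> real) \<Rightarrow> (nat \<Rightarrow> real^'n^'n) \<Rightarrow> (nat \<Rightarrow> real^'n) \<Rightarrow> nat \<Rightarrow> real^'n \<Rightarrow> real^'n" where
  "ifs_map \<rho> A \<delta> m x = \<rho> m *\<^sub>R (A m *v x) + \<delta> m"

definition similarity_ifs :: "nat \<Rightarrow> (nat \<Rightarrow> real) \<Rightarrow> (nat \<Rightarrow> real^'n^'n) \<Rightarrow> bool" where
  "similarity_ifs M \<rho> A \<longleftrightarrow>
     2 \<le> M \<and> (\<forall>m\<in>{1..M}. 0 < \<rho> m \<and> \<rho> m < 1 \<and> orthogonal_matrix (A m))"

(* For contractions there is exactly one such set (Hutchinson), so this predicate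
   determines \<Gamma>. *)
definition is_attractor :: "nat \<Rightarrow> (nat \<Rightarrow> real^'n \<Rightarrow> real^'n) \<Rightarrow> (real^'n) set \<Rightarrow> bool" where
  "is_attractor M s \<Gamma> \<longleftrightarrow> \<Gamma> \<noteq> {} \<and> compact \<Gamma> \<and> \<Gamma> = (\<Union>m\<in>{1..M}. s m ` \<Gamma>)"

definition open_set_condition :: "nat \<Rightarrow> (nat \<Rightarrow> real^'n \<Rightarrow> real^'n) \<Rightarrow> bool" where
  "open_set_condition M s \<longleftrightarrow>
     (\<exists>U. U \<noteq> {} \<and> bounded U \<and> open U \<and> (\<Union>m\<in>{1..M}. s m ` U) \<subseteq> U \<and>
        (\<forall>m\<in>{1..M}. \<forall>m'\<in>{1..M}. m \<noteq> m' \<longrightarrow> s m ` U \<inter> s m' ` U = {}))"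

(* Automatic for finite Borel measures on real^'n; kept as part of the notion of
   invariant measure. *)
definition regular_measure :: "(real^'n) measure \<Rightarrow> bool" where
  "regular_measure \<mu> \<longleftrightarrow>
     (\<forall>B\<in>sets borel.
        emeasure \<mu> B = (SUP K\<in>{K. K \<subseteq> B \<and> compact K}. emeasure \<mu> K) \<and>
        emeasure \<mu> B = (INF U\<in>{U. B \<subseteq> U \<and> open U}. emeasure \<mu> U))"

definition invariant_measure ::
  "nat \<Rightarrow> (nat \<Rightarrow> real^'n \<Rightarrow> real^'n) \<Rightarrow> (nat \<Rightarrow> real) \<Rightarrow> (real^'n) set \<Rightarrow> (real^'n) measure \<Rightarrow> bool" where
  "invariant_measure M s p \<Gamma> \<mu> \<longleftrightarrow>
     (\<forall>m\<in>{1..M}. 0 < p m \<and> p m < 1) \<and> (\<Sum>m=1..M. p m) = 1 \<and>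
     sets \<mu> = sets borel \<and> finite_measure \<mu> \<and> regular_measure \<mu> \<and>
     emeasure \<mu> UNIV \<noteq> 0 \<and> emeasure \<mu> (- \<Gamma>) = 0 \<and>
     (\<forall>B\<in>sets borel. measure \<mu> B = (\<Sum>m=1..M. p m * measure \<mu> (s m -` B)))"

(* Meant for x \<noteq> y. On the diagonal the library conventions ln 0 = 0 and 0 powr a = 0 give
   the value 0; in integrals of Phi t x \<eta> over x this is immaterial when \<mu> {\<eta>} = 0. *)
definition Phi :: "real \<Rightarrow> real^'n \<Rightarrow> real^'n \<Rightarrow> real" where
  "Phi t x y = (if t = 0 then ln (norm (x - y)) else norm (x - y) powr (- t))"

end

theory Submission
  imports Defs
begin

text \<open>
  Write \<open>f x = Phi t x \<eta>\<close>, \<open>a = \<rho> m powr - t\<close>, and \<open>b = ln (\<rho> m)\<close> if \<open>t = 0\<close>, \<open>b = 0\<close> otherwise.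
  Since \<open>s m\<close> fixes \<open>\<eta>\<close> and scales distances by \<open>\<rho> m\<close>, the kernel reproduces itself:
  \<open>f (s m x) = a * f x + b\<close> off \<open>\<eta>\<close>. Integrating the invariance of \<open>\<mu>\<close> against \<open>f\<close> gives
  \<open>\<integral>f = p m * (a * \<integral>f + b * \<mu> \<Gamma>) + (\<Sum>i\<noteq>m. p i * \<integral>(f \<circ> s i))\<close>, which can be solved for \<open>\<integral>f\<close>
  because \<open>t < tm\<close> says exactly that \<open>p m * a < 1\<close>. Three points need an argument.

  \<^item> Integrability (\<open>integrable_of_affine_bound\<close>). The same recursion, applied to the truncations
    \<open>min \<bar>f\<bar> n\<close>, bounds their integrals uniformly in \<open>n\<close>: the only unbounded contribution is
    multiplied by \<open>p m * a < 1\<close>, and on the other pieces \<open>f\<close> is continuous, since they are compact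
    and avoid \<open>\<eta>\<close>.

  \<^item> The point \<open>\<eta>\<close> is a null set (\<open>fixed_point_null\<close>): among the preimages of \<open>\<eta>\<close> under the maps
    only the one under \<open>s m\<close>, again \<open>\<eta>\<close>, meets \<open>\<Gamma>\<close>, so \<open>\<mu> {\<eta>} = p m * \<mu> {\<eta>}\<close>.

  \<^item> The term \<open>p i * \<integral>(f \<circ> s i)\<close> is the integral of \<open>f\<close> over the piece \<open>s i ` \<Gamma>\<close>
    (\<open>integral_piece\<close>). This needs that distinct pieces overlap only in null sets
    (\<open>vimage_piece_null\<close>), and it is here that the open set condition enters.

  For the overlaps, let \<open>n\<^sub>k x\<close> be the number of words \<open>w\<close> of length \<open>k\<close> with \<open>x \<in> s\<^sub>w ` \<Gamma>\<close>. Prefixing the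
  letter \<open>i\<close> to the words counted at \<open>x\<close> yields words counted at \<open>s i x\<close>, and if \<open>s i x\<close> also lies in
  another piece there is at least one more, starting with a different letter. Integrated against
  the invariant measure, this shows that \<open>\<integral>n\<^sub>k\<close> grows by at least \<open>p i * \<mu> (s i -` (s j ` \<Gamma>))\<close> in every
  step. But under the open set condition \<open>n\<^sub>k\<close> is bounded uniformly in \<open>k\<close> and \<open>x\<close>
  (\<open>word_count_bounded\<close>), so this increment vanishes.
\<close>

section \<open>Systems of similarities and their attractors\<close>

locale similarity_system =
  fixes I :: "'i set" and s :: "'i \<Rightarrow> 'a::euclidean_space \<Rightarrow> 'a"
    and r :: "'i \<Rightarrow> real" and \<Gamma> :: "'a set"
  assumes finite_I: "finite I"
    and ratio_pos: "\<And>i. i \<in> I \<Longrightarrow> 0 < r i"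
    and ratio_less_1: "\<And>i. i \<in> I \<Longrightarrow> r i < 1"
    and dist_s: "\<And>i x y. i \<in> I \<Longrightarrow> dist (s i x) (s i y) = r i * dist x y"
    and surj_s: "\<And>i. i \<in> I \<Longrightarrow> surj (s i)"
    and attractor_nonempty: "\<Gamma> \<noteq> {}"
    and attractor_compact: "compact \<Gamma>"
    and attractor_eq: "\<Gamma> = (\<Union>i\<in>I. s i ` \<Gamma>)"
begin

lemma inj_s: "inj (s i)" if "i \<in> I"
proof (rule injI)
  fix x y assume "s i x = s i y"
  then have "r i * dist x y = 0" using dist_s[OF that, of x y] by simp
  then show "x = y" using ratio_pos[OF that] by simp
qed

lemma inv_s [simp]: "i \<in> I \<Longrightarrow> inv (s i) (s i x) = x"
  by (simp add: inj_s)

lemma s_inv [simp]: "i \<in> I \<Longrightarrow> s i (inv (s i) x) = x"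
  by (simp add: surj_s surj_f_inv_f)

lemma continuous_s: "continuous_on A (s i)" if "i \<in> I"
proof (rule continuous_onI)
  fix x and e :: real assume "x \<in> A" "e > 0"
  then show "\<exists>d>0. \<forall>x'\<in>A. dist x' x < d \<longrightarrow> dist (s i x') (s i x) \<le> e"
    using ratio_pos[OF that]
    by (intro exI[of _ "e / r i"]) (auto simp: dist_s[OF that] field_simps)
qed

lemma continuous_inv_s: "continuous_on A (inv (s i))" if "i \<in> I"
proof (rule continuous_onI)
  fix x and e :: real assume "x \<in> A" "e > 0"
  have "dist y x = r i * dist (inv (s i) y) (inv (s i) x)" for y
    using dist_s[OF that, of "inv (s i) y" "inv (s i) x"] that by simp
  then show "\<exists>d>0. \<forall>x'\<in>A. dist x' x < d \<longrightarrow> dist (inv (s i) x') (inv (s i) x) \<le> e"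
    using ratio_pos[OF that] \<open>e > 0\<close>
    by (intro exI[of _ "r i * e"]) auto
qed

lemma s_measurable: "i \<in> I \<Longrightarrow> s i \<in> borel_measurable borel"
  by (rule borel_measurable_continuous_onI) (rule continuous_s)

lemma inv_s_measurable: "i \<in> I \<Longrightarrow> inv (s i) \<in> borel_measurable borel"
  by (rule borel_measurable_continuous_onI) (rule continuous_inv_s)

lemma image_ball_s: "s i ` ball c e = ball (s i c) (r i * e)" if "i \<in> I"
proof (intro equalityI subsetI)
  fix y assume "y \<in> ball (s i c) (r i * e)"
  then have "dist (s i c) (s i (inv (s i) y)) < r i * e" using that by simp
  then have "inv (s i) y \<in> ball c e"
    using ratio_pos[OF that] by (simp add: dist_s[OF that])
  then show "y \<in> s i ` ball c e" by (metis imageI s_inv that)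
qed (use ratio_pos[OF that] in \<open>auto simp: dist_s[OF that]\<close>)

lemma mem_piece_iff: "i \<in> I \<Longrightarrow> x \<in> s i ` \<Gamma> \<longleftrightarrow> inv (s i) x \<in> \<Gamma>"
  using s_inv[of i x] by (auto intro: rev_image_eqI)

lemma compact_piece: "i \<in> I \<Longrightarrow> compact (s i ` \<Gamma>)"
  using attractor_compact continuous_s compact_continuous_image by blast

lemma attractor_borel: "\<Gamma> \<in> sets borel"
  using attractor_compact borel_compact by blast

lemma piece_borel: "i \<in> I \<Longrightarrow> s i ` \<Gamma> \<in> sets borel"
  using compact_piece borel_compact by blast

lemma I_nonempty: "I \<noteq> {}"
  using attractor_nonempty attractor_eq by auto

text \<open>
  This is the number of words \<open>w\<close> of length \<open>k\<close> with \<open>x \<in> s\<^sub>w ` \<Gamma>\<close>. The recursion strips the first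
  letter, that is, the outermost map; this is the letter along which both the invariance of a
  measure and the disjointness in the open set condition can be used.
\<close>

primrec word_count :: "nat \<Rightarrow> 'a \<Rightarrow> nat" where
  "word_count 0 x = of_bool (x \<in> \<Gamma>)"
| "word_count (Suc k) x = (\<Sum>i\<in>I. word_count k (inv (s i) x))"

lemma word_count_pos: "x \<in> \<Gamma> \<Longrightarrow> 1 \<le> word_count k x"
proof (induction k arbitrary: x)
  case (Suc k)
  then obtain i where i: "i \<in> I" "inv (s i) x \<in> \<Gamma>"
    using attractor_eq mem_piece_iff by blast
  have "word_count k (inv (s i) x) \<le> word_count (Suc k) x"
    using member_le_sum[of i I "\<lambda>i. word_count k (inv (s i) x)"] i finite_I by simp
  with Suc.IH[OF i(2)] show ?case by linarith
qed simp

lemma word_count_measurable: "word_count k \<in> borel \<rightarrow>\<^sub>M count_space UNIV"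
proof (induction k)
  case 0
  have "(\<lambda>x. if x \<in> \<Gamma> then 1 else 0::nat) \<in> borel \<rightarrow>\<^sub>M count_space UNIV"
    using attractor_borel by (intro measurable_If_set) auto
  then show ?case by (simp add: of_bool_def)
next
  case (Suc k)
  have "(\<lambda>x. word_count k (inv (s i) x)) \<in> borel \<rightarrow>\<^sub>M count_space UNIV" if "i \<in> I" for i
    using measurable_compose[OF inv_s_measurable[OF that] Suc.IH] .
  then show ?case by (simp add: measurable_sum_nat)
qed

lemma word_count_le_Suc_s:
  assumes "i \<in> I"
  shows "word_count k x \<le> word_count (Suc k) (s i x)"
  using member_le_sum[of i I "\<lambda>l. word_count k (inv (s l) (s i x))"] assms finite_I by simp

text \<open>
  A point of \<open>s i ` \<Gamma>\<close> lying in a second piece \<open>s j ` \<Gamma>\<close> has a coding starting with \<open>j\<close> besides those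
  inherited through \<open>s i\<close>.
\<close>

lemma word_count_less_Suc_s:
  assumes i: "i \<in> I" and j: "j \<in> I" "i \<noteq> j"
  shows "word_count k x + of_bool (s i x \<in> s j ` \<Gamma>) \<le> word_count (Suc k) (s i x)"
proof -
  let ?f = "\<lambda>l. word_count k (inv (s l) (s i x))"
  have "?f i + ?f j = sum ?f {i, j}" using j by simp
  also have "\<dots> \<le> sum ?f I" using i j finite_I by (intro sum_mono2) auto
  also have "\<dots> = word_count (Suc k) (s i x)" by simp
  finally have "word_count k x + ?f j \<le> word_count (Suc k) (s i x)" using i by simp
  moreover have "of_bool (s i x \<in> s j ` \<Gamma>) \<le> ?f j"
    using word_count_pos mem_piece_iff[OF j(1)] by auto
  ultimately show ?thesis by linarith
qed

end

section \<open>The open set condition bounds the number of codings\<close>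

text \<open>The volumes of the disjoint balls add up to at most the volume of \<open>ball x e\<close>.\<close>

lemma card_disjoint_balls_le:
  fixes C :: "'a::euclidean_space set"
  assumes "finite C" and "0 < \<epsilon>" and "0 < e"
    and disj: "disjoint_family_on (\<lambda>c. ball c (\<epsilon> * e)) C"
    and sub: "\<And>c. c \<in> C \<Longrightarrow> ball c (\<epsilon> * e) \<subseteq> ball x e"
  shows "real (card C) \<le> (1 / \<epsilon>) ^ DIM('a)"
proof -
  let ?v = "unit_ball_vol (real DIM('a))"
  have v: "?v > 0" by simp
  have "real (card C) * (?v * (\<epsilon> * e) ^ DIM('a)) = (\<Sum>c\<in>C. measure lborel (ball c (\<epsilon> * e)))"
    using assms(2,3) by (simp add: content_ball)
  also have "\<dots> = measure lborel (\<Union>c\<in>C. ball c (\<epsilon> * e))"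
    using disj \<open>finite C\<close> emeasure_lborel_ball_finite
    by (intro measure_finite_Union[symmetric]) (auto simp: less_top)
  also have "\<dots> \<le> measure lborel (ball x e)"
    using sub \<open>finite C\<close> emeasure_lborel_ball_finite[of x e]
    by (intro measure_mono_fmeasurable) (auto simp: fmeasurable_def intro!: borel_open)
  also have "\<dots> = ?v * e ^ DIM('a)" using \<open>0 < e\<close> by (simp add: content_ball)
  finally have "(real (card C) * \<epsilon> ^ DIM('a)) * (?v * e ^ DIM('a)) \<le> 1 * (?v * e ^ DIM('a))"
    by (simp add: power_mult_distrib mult_ac)
  then have "real (card C) * \<epsilon> ^ DIM('a) \<le> 1"
    using v \<open>0 < e\<close> by (subst (asm) mult_le_cancel_right_pos) auto
  then show ?thesis using \<open>0 < \<epsilon>\<close> by (simp add: power_divide field_simps)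
qed

locale open_set_system = similarity_system I s r \<Gamma>
  for I :: "'i set" and s :: "'i \<Rightarrow> 'a::euclidean_space \<Rightarrow> 'a"
    and r :: "'i \<Rightarrow> real" and \<Gamma> :: "'a set" +
  fixes U :: "'a set"
  assumes U_nonempty: "U \<noteq> {}"
    and U_bounded: "bounded U"
    and U_open: "open U"
    and U_invariant: "\<And>i. i \<in> I \<Longrightarrow> s i ` U \<subseteq> U"
    and U_disjoint: "\<And>i j. i \<in> I \<Longrightarrow> j \<in> I \<Longrightarrow> i \<noteq> j \<Longrightarrow> s i ` U \<inter> s j ` U = {}"
begin

text \<open>
  The rescaling step of both inductions below: balls of relative size \<open>\<epsilon>\<close> at scale \<open>e / r i\<close> near a
  preimage become balls of the same relative size at scale \<open>e\<close>, because similarities map balls to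
  balls.
\<close>

lemma image_ball_subset:
  assumes i: "i \<in> I" and sub: "ball c (\<epsilon> * (e / r i)) \<subseteq> U \<inter> ball (inv (s i) x) (e / r i)"
  shows "ball (s i c) (\<epsilon> * e) \<subseteq> s i ` U \<inter> ball x e"
proof -
  have "ball (s i c) (\<epsilon> * e) = s i ` ball c (\<epsilon> * (e / r i))"
    using ratio_pos[OF i] by (simp add: image_ball_s[OF i])
  also have "\<dots> \<subseteq> s i ` U \<inter> s i ` ball (inv (s i) x) (e / r i)"
    using sub by blast
  also have "s i ` ball (inv (s i) x) (e / r i) = ball x e"
    using ratio_pos[OF i] i by (simp add: image_ball_s[OF i])
  finally show ?thesis .
qed

text \<open>
  At scales comparable to the diameter of \<open>\<Gamma> \<union> U\<close> any ball in \<open>U\<close> serves for all points of \<open>\<Gamma>\<close>. A point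
  \<open>x\<close> with a smaller scale is blown up by the inverse of a map whose piece contains \<open>x\<close>, which
  preserves membership in \<open>\<Gamma>\<close> and moves the scale up by a factor at most \<open>1 / \<rho>0\<close>, where \<open>\<rho>0\<close> is the
  smallest ratio; repeating this, the scale lands in the window between the diameter bound \<open>D\<close> and
  \<open>R = D / \<rho>0\<close>.
\<close>

lemma inner_ball_near_attractor:
  obtains \<epsilon> R where "0 < \<epsilon>" "0 < R"
    "\<And>x e. x \<in> \<Gamma> \<Longrightarrow> 0 < e \<Longrightarrow> e \<le> R \<Longrightarrow> \<exists>c. ball c (\<epsilon> * e) \<subseteq> U \<inter> ball x e"
proof -
  obtain u a where ua: "0 < a" "ball u a \<subseteq> U"
    using U_nonempty U_open by (metis ex_in_conv open_contains_ball)
  obtain D where D: "0 < D" "\<And>x y. x \<in> \<Gamma> \<Longrightarrow> y \<in> U \<Longrightarrow> dist x y < D"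
  proof -
    have "bounded (\<Gamma> \<union> U)" using U_bounded attractor_compact compact_imp_bounded by auto
    then obtain B where B: "\<forall>x\<in>\<Gamma>\<union>U. \<forall>y\<in>\<Gamma>\<union>U. dist x y \<le> B"
      using bounded_two_points by blast
    have "dist x y < \<bar>B\<bar> + 1" if "x \<in> \<Gamma>" "y \<in> U" for x y
    proof -
      have "dist x y \<le> B" using B that by blast
      then show ?thesis by linarith
    qed
    then show ?thesis using that[of "\<bar>B\<bar> + 1"] by simp
  qed
  define \<rho>0 where "\<rho>0 = Min (r ` I)"
  define \<rho>1 where "\<rho>1 = Max (r ` I)"
  have \<rho>0: "0 < \<rho>0" "\<And>i. i \<in> I \<Longrightarrow> \<rho>0 \<le> r i"
    unfolding \<rho>0_def using finite_I I_nonempty ratio_pos by auto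
  have \<rho>1: "\<rho>1 < 1" "\<And>i. i \<in> I \<Longrightarrow> r i \<le> \<rho>1" 
    unfolding \<rho>1_def using finite_I I_nonempty ratio_less_1 by auto
  have \<rho>1_pos: "0 < \<rho>1" using I_nonempty \<rho>1(2) ratio_pos by fastforce
  define R where "R = D / \<rho>0"
  define \<epsilon> where "\<epsilon> = a / R"
  have R: "0 < R" "D = \<rho>0 * R" using D \<rho>0 by (auto simp: R_def)
  have \<epsilon>: "0 < \<epsilon>" using ua R by (simp add: \<epsilon>_def)
  have large: "\<exists>c. ball c (\<epsilon> * e) \<subseteq> U \<inter> ball x e" if "x \<in> \<Gamma>" "D \<le> e" "e \<le> R" for x e
  proof -
    have "\<epsilon> * e \<le> a" using that R ua by (simp add: \<epsilon>_def field_simps)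
    then have "ball u (\<epsilon> * e) \<subseteq> U" using ua(2) subset_ball by blast
    moreover have "U \<subseteq> ball x e" using D(2)[OF that(1)] that(2) by fastforce
    ultimately show ?thesis by blast
  qed
  \<comment> \<open>Every blow-up gains at least the factor \<open>1 / \<rho>1\<close>, with the largest ratio \<open>\<rho>1\<close>, so \<open>j\<close> of them suffice for scales down to
    \<open>\<rho>1 ^ j * D\<close>.\<close>
  have scales: "\<exists>c. ball c (\<epsilon> * e) \<subseteq> U \<inter> ball x e"
    if "x \<in> \<Gamma>" "\<rho>1 ^ j * D \<le> e" "e \<le> R" for x e j
    using that
  proof (induction j arbitrary: x e)
    case 0
    then show ?case using large by simp
  next
    case (Suc j)
    show ?case
    proof (cases "D \<le> e")
      case True
      then show ?thesis using large Suc.prems by blast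
    next
      case False
      obtain i where i: "i \<in> I" "inv (s i) x \<in> \<Gamma>"
        using Suc.prems(1) attractor_eq mem_piece_iff by blast
      have rp: "0 < r i" using ratio_pos[OF i(1)] .
      have "e \<le> r i * R"
        using False R(2) mult_right_mono[OF \<rho>0(2)[OF i(1)], of R] R(1) by linarith
      moreover have "r i * (\<rho>1 ^ j * D) \<le> e"
      proof -
        have "r i * (\<rho>1 ^ j * D) \<le> \<rho>1 * (\<rho>1 ^ j * D)"
          using \<rho>1(2)[OF i(1)] \<rho>1_pos D(1) by (intro mult_right_mono) auto
        then show ?thesis using Suc.prems(2) by (simp add: mult_ac)
      qed
      ultimately obtain c where "ball c (\<epsilon> * (e / r i)) \<subseteq> U \<inter> ball (inv (s i) x) (e / r i)"
        using Suc.IH[OF i(2), of "e / r i"] rp by (auto simp: field_simps)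
      then show ?thesis using image_ball_subset[OF i(1)] U_invariant[OF i(1)] by blast
    qed
  qed
  have "\<exists>c. ball c (\<epsilon> * e) \<subseteq> U \<inter> ball x e" if "x \<in> \<Gamma>" "0 < e" "e \<le> R" for x e
  proof -
    have "0 < e / D" using that D(1) by simp
    then obtain j where "\<rho>1 ^ j < e / D"
      using real_arch_pow_inv \<rho>1(1) by blast
    then show ?thesis using scales[OF that(1) _ that(3), of j] D(1) by (simp add: field_simps)
  qed
  then show ?thesis using that \<epsilon> R(1) by blast
qed

text \<open>
  Each word counted at \<open>x\<close> contributes a ball of radius \<open>\<epsilon> * e\<close> inside \<open>ball x e\<close>, and balls of words with
  different letters are disjoint because they lie in disjoint images of \<open>U\<close>; a volume comparison then
  bounds the number of words. Words of the same length have very different contraction ratios, so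
  the sets \<open>s\<^sub>w ` U\<close> themselves are not comparable in size. This is why \<open>e\<close> is taken so small, at most
  \<open>\<rho>0 ^ k * R\<close> with the smallest ratio \<open>\<rho>0\<close>: pulled back along any word of length \<open>k\<close> it is still a scale at which the preceding
  lemma provides a ball, and all balls have the same radius at the scale of \<open>x\<close>.
\<close>

lemma word_count_bounded: "\<exists>N. \<forall>k x. real (word_count k x) \<le> N"
proof -
  obtain \<epsilon> R where \<epsilon>: "0 < \<epsilon>" and R: "0 < R"
    and base: "\<And>x e. x \<in> \<Gamma> \<Longrightarrow> 0 < e \<Longrightarrow> e \<le> R \<Longrightarrow> \<exists>c. ball c (\<epsilon> * e) \<subseteq> U \<inter> ball x e"
    using inner_ball_near_attractor by blast
  define \<rho>0 where "\<rho>0 = Min (r ` I)"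
  have \<rho>0: "0 < \<rho>0" "\<And>i. i \<in> I \<Longrightarrow> \<rho>0 \<le> r i"
    unfolding \<rho>0_def using finite_I I_nonempty ratio_pos by auto
  have packing: "\<exists>C. finite C \<and> card C = word_count k x \<and>
      disjoint_family_on (\<lambda>c. ball c (\<epsilon> * e)) C \<and> (\<forall>c\<in>C. ball c (\<epsilon> * e) \<subseteq> U \<inter> ball x e)"
    if "0 < e" "e \<le> \<rho>0 ^ k * R" for k x e
    using that
  proof (induction k arbitrary: x e)
    case 0
    show ?case
    proof (cases "x \<in> \<Gamma>")
      case True
      moreover have "e \<le> R" using 0 by simp
      ultimately obtain c where "ball c (\<epsilon> * e) \<subseteq> U \<inter> ball x e" using base 0(1) by blast
      then show ?thesis using True
        by (intro exI[of _ "{c}"]) (auto simp: disjoint_family_on_def)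
    qed (auto intro!: exI[of _ "{}"] simp: disjoint_family_on_def)
  next
    case (Suc k)
    have "\<exists>C. finite C \<and> card C = word_count k (inv (s i) x) \<and>
        disjoint_family_on (\<lambda>c. ball c (\<epsilon> * (e / r i))) C \<and>
        (\<forall>c\<in>C. ball c (\<epsilon> * (e / r i)) \<subseteq> U \<inter> ball (inv (s i) x) (e / r i))" if "i \<in> I" for i
    proof (rule Suc.IH)
      show "0 < e / r i" using Suc.prems ratio_pos[OF that] by simp
      have "\<rho>0 * (\<rho>0 ^ k * R) \<le> r i * (\<rho>0 ^ k * R)"
        using \<rho>0 that R by (intro mult_right_mono) auto
      then show "e / r i \<le> \<rho>0 ^ k * R"
        using Suc.prems ratio_pos[OF that] by (simp add: field_simps)
    qed
    then obtain C where C: "\<And>i. i \<in> I \<Longrightarrow> finite (C i)"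
        "\<And>i. i \<in> I \<Longrightarrow> card (C i) = word_count k (inv (s i) x)"
        "\<And>i. i \<in> I \<Longrightarrow> disjoint_family_on (\<lambda>c. ball c (\<epsilon> * (e / r i))) (C i)"
        "\<And>i c. i \<in> I \<Longrightarrow> c \<in> C i \<Longrightarrow> ball c (\<epsilon> * (e / r i)) \<subseteq> U \<inter> ball (inv (s i) x) (e / r i)"
      by metis
    let ?C = "\<Union>i\<in>I. s i ` C i"
    have ball: "ball (s i c) (\<epsilon> * e) \<subseteq> s i ` U \<inter> ball x e" if "i \<in> I" "c \<in> C i" for i c
      using image_ball_subset C(4) that by blast
    have \<epsilon>e: "0 < \<epsilon> * e" using \<epsilon> Suc.prems by simp
    have cross: "ball (s i c) (\<epsilon> * e) \<inter> ball (s j d) (\<epsilon> * e) = {}"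
      if "i \<in> I" "j \<in> I" "i \<noteq> j" "c \<in> C i" "d \<in> C j" for i j c d
      using ball[OF that(1,4)] ball[OF that(2,5)] U_disjoint[OF that(1-3)] by blast
    have "card ?C = (\<Sum>i\<in>I. card (s i ` C i))"
    proof (rule card_UN_disjoint)
      show "\<forall>i\<in>I. \<forall>j\<in>I. i \<noteq> j \<longrightarrow> s i ` C i \<inter> s j ` C j = {}"
      proof (intro ballI impI)
        fix i j assume ij: "i \<in> I" "j \<in> I" "i \<noteq> j"
        have False if "y \<in> s i ` C i" "y \<in> s j ` C j" for y
        proof -
          from that obtain c d where "c \<in> C i" "d \<in> C j" "y = s i c" "y = s j d" by auto
          then show False using cross[OF ij, of c d] \<epsilon>e by auto
        qed
        then show "s i ` C i \<inter> s j ` C j = {}" by blast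
      qed
    qed (use finite_I C(1) in auto)
    also have "\<dots> = (\<Sum>i\<in>I. card (C i))"
      using inj_s by (intro sum.cong refl card_image) (metis inj_on_subset subset_UNIV)
    also have "\<dots> = word_count (Suc k) x" using C(2) by simp
    finally have card: "card ?C = word_count (Suc k) x" .
    have "disjoint_family_on (\<lambda>c. ball c (\<epsilon> * e)) ?C"
      unfolding disjoint_family_on_def
    proof (intro ballI impI)
      fix y z assume "y \<in> ?C" "z \<in> ?C" "y \<noteq> z"
      then obtain i j c d where yz: "i \<in> I" "j \<in> I" "c \<in> C i" "d \<in> C j" "y = s i c" "z = s j d"
        by auto
      show "ball y (\<epsilon> * e) \<inter> ball z (\<epsilon> * e) = {}"
      proof (cases "i = j")
        case True
        then have "c \<noteq> d" using yz \<open>y \<noteq> z\<close> by auto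
        then have "ball c (\<epsilon> * (e / r i)) \<inter> ball d (\<epsilon> * (e / r i)) = {}"
          using C(3)[OF yz(1)] yz True unfolding disjoint_family_on_def by blast
        then have "s i ` ball c (\<epsilon> * (e / r i)) \<inter> s i ` ball d (\<epsilon> * (e / r i)) = {}"
          using inj_s[OF yz(1)] by (simp add: image_Int[symmetric])
        then have "ball (s i c) (\<epsilon> * e) \<inter> ball (s i d) (\<epsilon> * e) = {}"
          using ratio_pos[OF yz(1)] by (simp add: image_ball_s[OF yz(1)])
        then show ?thesis using True yz(5,6) by simp
      qed (use cross yz in auto)
    qed
    moreover have "\<forall>c\<in>?C. ball c (\<epsilon> * e) \<subseteq> U \<inter> ball x e"
      using ball U_invariant by blast
    moreover have "finite ?C" using finite_I C(1) by blast
    ultimately show ?case using card by blast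
  qed
  have "real (word_count k x) \<le> (1 / \<epsilon>) ^ DIM('a)" for k x
  proof -
    have e: "0 < \<rho>0 ^ k * R" using \<rho>0 R by simp
    obtain C where "finite C" "card C = word_count k x"
      "disjoint_family_on (\<lambda>c. ball c (\<epsilon> * (\<rho>0 ^ k * R))) C"
      "\<forall>c\<in>C. ball c (\<epsilon> * (\<rho>0 ^ k * R)) \<subseteq> U \<inter> ball x (\<rho>0 ^ k * R)"
      using packing[OF e order_refl] by blast
    then show ?thesis using card_disjoint_balls_le[OF _ \<epsilon> e, of C x] by auto
  qed
  then show ?thesis by blast
qed

end

section \<open>Invariant measures\<close>

locale self_similar_measure = open_set_system I s r \<Gamma> U + finite_measure \<mu>
  for I :: "'i set" and s :: "'i \<Rightarrow> 'a::euclidean_space \<Rightarrow> 'a"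
    and r :: "'i \<Rightarrow> real" and \<Gamma> U :: "'a set" and \<mu> :: "'a measure" +
  fixes p :: "'i \<Rightarrow> real"
  assumes weight_pos: "\<And>i. i \<in> I \<Longrightarrow> 0 < p i"
    and weights_sum: "(\<Sum>i\<in>I. p i) = 1"
    and sets_\<mu>: "sets \<mu> = sets borel"
    and supported: "emeasure \<mu> (- \<Gamma>) = 0"
    and invariant: "\<And>B. B \<in> sets borel \<Longrightarrow>
      measure \<mu> B = (\<Sum>i\<in>I. p i * measure \<mu> (s i -` B))"
begin

lemma space_\<mu>: "space \<mu> = UNIV"
  using sets_eq_imp_space_eq[OF sets_\<mu>] by simp

lemma measurable_\<mu>: "measurable \<mu> N = measurable borel N"
  by (rule measurable_cong_sets) (simp_all add: sets_\<mu>)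

lemma compose_s_measurable:
  "i \<in> I \<Longrightarrow> f \<in> borel \<rightarrow>\<^sub>M N \<Longrightarrow> (\<lambda>x. f (s i x)) \<in> borel \<rightarrow>\<^sub>M N"
  using measurable_compose[OF s_measurable] .

lemma AE_attractor: "AE x in \<mu>. x \<in> \<Gamma>"
proof (rule AE_I[of _ _ "- \<Gamma>"])
  show "- \<Gamma> \<in> sets \<mu>" using attractor_borel by (simp add: sets_\<mu> borel_comp)
qed (use supported in auto)

lemma nn_integral_invariant:
  assumes "f \<in> borel_measurable borel"
  shows "(\<integral>\<^sup>+x. f x \<partial>\<mu>) = (\<Sum>i\<in>I. ennreal (p i) * (\<integral>\<^sup>+x. f (s i x) \<partial>\<mu>))"
  using assms
proof (induction rule: borel_measurable_induct)
  case (cong f g)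
  then have "f = g" by auto
  with cong show ?case by simp
next
  case (set B)
  have vB: "s i -` B \<in> sets \<mu>" if "i \<in> I" for i
    using measurable_sets[OF s_measurable[OF that] set] by (simp add: sets_\<mu>)
  have eq: "(\<lambda>x. indicator B (s i x)) = indicator (s i -` B)" for i
    by (auto simp: indicator_def)
  have "emeasure \<mu> B = ennreal (\<Sum>i\<in>I. p i * measure \<mu> (s i -` B))"
    using invariant[OF set] by (simp add: emeasure_eq_measure)
  also have "\<dots> = (\<Sum>i\<in>I. ennreal (p i) * emeasure \<mu> (s i -` B))"
    using weight_pos by (subst sum_ennreal[symmetric])
      (auto simp: emeasure_eq_measure ennreal_mult less_imp_le intro!: sum.cong)
  finally show ?case using set vB by (simp add: eq sets_\<mu>)
next
  case (mult u c)
  then show ?case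
    by (simp add: nn_integral_cmult measurable_\<mu> compose_s_measurable sum_distrib_left mult_ac)
next
  case (add u v)
  then show ?case
    by (simp add: nn_integral_add measurable_\<mu> compose_s_measurable sum.distrib distrib_left)
next
  case (seq V)
  have V: "(\<lambda>n. V n x) \<longlonglongrightarrow> (SUP n. V n x)" for x
    using seq(3) by (intro LIMSEQ_SUP) (auto simp: incseq_def le_fun_def)
  have sup: "(SUP n. V n) x = (SUP n. V n x)" for x by (simp add: image_comp)
  have lim: "(\<lambda>n. \<integral>\<^sup>+x. V n (h x) \<partial>\<mu>) \<longlonglongrightarrow> (\<integral>\<^sup>+x. (SUP n. V n) (h x) \<partial>\<mu>)"
    if "h \<in> borel_measurable borel" for h
    unfolding sup using seq(3) V measurable_compose[OF that seq(1)]
    by (intro nn_integral_LIMSEQ) (auto simp: measurable_\<mu> incseq_def le_fun_def)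
  have "(\<lambda>n. \<integral>\<^sup>+x. V n x \<partial>\<mu>) \<longlonglongrightarrow> (\<Sum>i\<in>I. ennreal (p i) * (\<integral>\<^sup>+x. (SUP n. V n) (s i x) \<partial>\<mu>))"
    unfolding seq.IH using lim s_measurable
    by (intro tendsto_sum ennreal_tendsto_cmult) (auto simp: less_top[symmetric])
  moreover have "(\<lambda>n. \<integral>\<^sup>+x. V n x \<partial>\<mu>) \<longlonglongrightarrow> (\<integral>\<^sup>+x. (SUP n. V n) x \<partial>\<mu>)"
    using lim[of "\<lambda>x. x"] by simp
  ultimately show ?case using LIMSEQ_unique by blast
qed

lemma integrable_compose_s:
  fixes f :: "'a \<Rightarrow> real"
  assumes i: "i \<in> I" and f: "f \<in> borel_measurable borel" "integrable \<mu> f"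
  shows "integrable \<mu> (\<lambda>x. f (s i x))"
proof (rule integrableI_bounded)
  show "(\<lambda>x. f (s i x)) \<in> borel_measurable \<mu>"
    using compose_s_measurable[OF i f(1)] by (simp add: measurable_\<mu>)
  have "ennreal (p i) * (\<integral>\<^sup>+x. norm (f (s i x)) \<partial>\<mu>) \<le> (\<integral>\<^sup>+x. norm (f x) \<partial>\<mu>)"
  proof -
    have "(\<lambda>x. ennreal (norm (f x))) \<in> borel_measurable borel" using f(1) by simp
    from nn_integral_invariant[OF this] show ?thesis
      using member_le_sum[of i I "\<lambda>i. ennreal (p i) * (\<integral>\<^sup>+x. norm (f (s i x)) \<partial>\<mu>)"] i finite_I
      by simp
  qed
  also have "\<dots> < \<infinity>" using f(2) by (simp add: integrable_iff_bounded)
  finally show "(\<integral>\<^sup>+x. norm (f (s i x)) \<partial>\<mu>) < \<infinity>"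
    using weight_pos[OF i] by (auto simp: ennreal_mult_less_top)
qed

lemma integral_invariant:
  fixes f :: "'a \<Rightarrow> real"
  assumes f: "f \<in> borel_measurable borel" "integrable \<mu> f"
  shows "(\<integral>x. f x \<partial>\<mu>) = (\<Sum>i\<in>I. p i * (\<integral>x. f (s i x) \<partial>\<mu>))"
proof -
  have nonneg: "(\<integral>x. g x \<partial>\<mu>) = (\<Sum>i\<in>I. p i * (\<integral>x. g (s i x) \<partial>\<mu>))"
    if g: "g \<in> borel_measurable borel" "integrable \<mu> g" "\<And>x. 0 \<le> g x" for g :: "'a \<Rightarrow> real"
  proof -
    have "ennreal (\<integral>x. g x \<partial>\<mu>) = (\<integral>\<^sup>+x. g x \<partial>\<mu>)"
      using g by (simp add: nn_integral_eq_integral)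
    also have "\<dots> = (\<Sum>i\<in>I. ennreal (p i) * (\<integral>\<^sup>+x. g (s i x) \<partial>\<mu>))"
      using g by (intro nn_integral_invariant) auto
    also have "\<dots> = (\<Sum>i\<in>I. ennreal (p i * (\<integral>x. g (s i x) \<partial>\<mu>)))"
      using g integrable_compose_s weight_pos
      by (intro sum.cong refl) (simp add: nn_integral_eq_integral ennreal_mult less_imp_le)
    also have "\<dots> = ennreal (\<Sum>i\<in>I. p i * (\<integral>x. g (s i x) \<partial>\<mu>))"
      using g weight_pos by (intro sum_ennreal) (auto simp: less_imp_le)
    finally show ?thesis
      using g weight_pos by (subst (asm) ennreal_inj) (auto intro!: sum_nonneg simp: less_imp_le)
  qed
  let ?P = "\<lambda>x. max (f x) 0" and ?N = "\<lambda>x. max (- f x) 0"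
  have split: "f x = ?P x - ?N x" for x by simp
  have PN: "?P \<in> borel_measurable borel" "?N \<in> borel_measurable borel"
    "integrable \<mu> ?P" "integrable \<mu> ?N" using f by auto
  have "(\<integral>x. f x \<partial>\<mu>) = (\<integral>x. ?P x \<partial>\<mu>) - (\<integral>x. ?N x \<partial>\<mu>)"
    using PN by (subst split) simp
  also have "\<dots> = (\<Sum>i\<in>I. p i * ((\<integral>x. ?P (s i x) \<partial>\<mu>) - (\<integral>x. ?N (s i x) \<partial>\<mu>)))"
    using nonneg[of ?P] nonneg[of ?N] PN by (simp add: sum_subtractf right_diff_distrib)
  also have "\<dots> = (\<Sum>i\<in>I. p i * (\<integral>x. f (s i x) \<partial>\<mu>))"
  proof (intro sum.cong refl)
    fix i assume "i \<in> I"
    then have "integrable \<mu> (\<lambda>x. ?P (s i x))" "integrable \<mu> (\<lambda>x. ?N (s i x))"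
      using PN integrable_compose_s[of i ?P] integrable_compose_s[of i ?N] by auto
    from Bochner_Integration.integral_diff[OF this]
    show "p i * ((\<integral>x. ?P (s i x) \<partial>\<mu>) - (\<integral>x. ?N (s i x) \<partial>\<mu>)) = p i * (\<integral>x. f (s i x) \<partial>\<mu>)"
      by (simp add: split[symmetric])
  qed
  finally show ?thesis .
qed

text \<open>
  The integrals of the counting functions are bounded, but each step of the recursion increases
  them by at least \<open>p i\<close> times the measure of the overlap, seen from inside \<open>s i\<close>.
\<close>

lemma vimage_piece_null:
  assumes i: "i \<in> I" and j: "j \<in> I" "i \<noteq> j"
  shows "AE x in \<mu>. s i x \<notin> s j ` \<Gamma>"
proof -
  obtain N where N: "\<And>k x. real (word_count k x) \<le> N" using word_count_bounded by blast
  let ?E = "\<lambda>k. \<integral>x. real (word_count k x) \<partial>\<mu>"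
  let ?B = "s i -` (s j ` \<Gamma>)"
  have B: "?B \<in> sets \<mu>"
    using measurable_sets[OF s_measurable[OF i] piece_borel[OF j(1)]] by (simp add: sets_\<mu>)
  have meas: "(\<lambda>x. real (word_count k x)) \<in> borel_measurable borel" for k
    using measurable_compose[OF word_count_measurable, of real] by simp
  have int: "integrable \<mu> (\<lambda>x. real (word_count k x))" for k
    by (rule integrable_const_bound[of _ N]) (use N meas in \<open>auto simp: measurable_\<mu>\<close>)
  have intB: "integrable \<mu> (indicator ?B :: 'a \<Rightarrow> real)"
    using B by (intro integrable_real_indicator) (auto simp: less_top[symmetric])
  have ints: "integrable \<mu> (\<lambda>x. real (word_count k (s l x)))" if "l \<in> I" for k l
    using integrable_compose_s[OF that meas int] .
  have step: "?E k + p i * measure \<mu> ?B \<le> ?E (Suc k)" for k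
  proof -
    have "p l * ?E k + (if l = i then p i * measure \<mu> ?B else 0)
        \<le> p l * (\<integral>x. real (word_count (Suc k) (s l x)) \<partial>\<mu>)" if l: "l \<in> I" for l
    proof -
      have "?E k + (if l = i then measure \<mu> ?B else 0) \<le> (\<integral>x. real (word_count (Suc k) (s l x)) \<partial>\<mu>)"
      proof (cases "l = i")
        case True
        have "real (word_count k x) + indicator ?B x \<le> real (word_count (Suc k) (s i x))" for x
        proof -
          have "real (word_count k x + of_bool (s i x \<in> s j ` \<Gamma>)) \<le> real (word_count (Suc k) (s i x))"
            using word_count_less_Suc_s[OF i j] by (rule of_nat_mono)
          then show ?thesis by (simp add: indicator_def del: word_count.simps)
        qed
        then have "(\<integral>x. real (word_count k x) + indicator ?B x \<partial>\<mu>)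
            \<le> (\<integral>x. real (word_count (Suc k) (s i x)) \<partial>\<mu>)"
          by (intro integral_mono Bochner_Integration.integrable_add int intB ints[OF i])
        with True show ?thesis using int intB B by (simp del: word_count.simps)
      next
        case False
        then show ?thesis using word_count_le_Suc_s[OF l]
          by (auto intro!: integral_mono int ints[OF l] simp del: word_count.simps)
      qed
      from mult_left_mono[OF this, of "p l"] weight_pos[OF l] show ?thesis
        by (auto simp: distrib_left simp del: word_count.simps split: if_splits)
    qed
    then have "(\<Sum>l\<in>I. p l * ?E k + (if l = i then p i * measure \<mu> ?B else 0)) \<le> ?E (Suc k)"
      unfolding integral_invariant[OF meas int, of "Suc k"] by (rule sum_mono)
    then show ?thesis
      using i finite_I weights_sum
      by (simp add: sum.distrib sum_distrib_right[symmetric] del: word_count.simps)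
  qed
  have grow: "real k * (p i * measure \<mu> ?B) \<le> ?E k" for k
  proof (induction k)
    case (Suc k)
    then show ?case using step[of k] by (simp add: algebra_simps)
  qed simp
  have upper: "?E k \<le> N * measure \<mu> UNIV" for k
    using integral_mono[OF int[of k] integrable_const[of N]] N by (simp add: space_\<mu> mult.commute)
  have "p i * measure \<mu> ?B \<le> 0"
  proof (rule ccontr)
    assume "\<not> ?thesis"
    then obtain k where "N * measure \<mu> UNIV < real k * (p i * measure \<mu> ?B)"
      using reals_Archimedean3 by (meson not_le)
    with grow[of k] upper[of k] show False by linarith
  qed
  then have "measure \<mu> ?B = 0"
    using weight_pos[OF i] by (smt (verit) measure_nonneg mult_pos_pos zero_less_mult_iff)
  then have "emeasure \<mu> ?B = 0" by (simp add: emeasure_eq_measure)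
  then show ?thesis using B by (intro AE_I[of _ _ ?B]) auto
qed

text \<open>
  In the invariance relation for the function \<open>f\<close> cut off outside \<open>s i ` \<Gamma>\<close>, the terms of the other maps
  vanish because the pieces overlap only in null sets.
\<close>

lemma integral_piece:
  fixes f :: "'a \<Rightarrow> real"
  assumes i: "i \<in> I" and f: "f \<in> borel_measurable borel" "integrable \<mu> f"
  shows "(LINT x:(s i ` \<Gamma>)|\<mu>. f x) = p i * (\<integral>x. f (s i x) \<partial>\<mu>)"
proof -
  let ?f = "\<lambda>x. indicator (s i ` \<Gamma>) x *\<^sub>R f x"
  have "?f \<in> borel_measurable borel" using f piece_borel[OF i] by measurable
  moreover have "integrable \<mu> ?f"
    using f piece_borel[OF i] by (intro integrable_mult_indicator) (auto simp: sets_\<mu>)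
  ultimately have "(\<integral>x. ?f x \<partial>\<mu>) = (\<Sum>j\<in>I. p j * (\<integral>x. ?f (s j x) \<partial>\<mu>))"
    by (rule integral_invariant)
  also have "\<dots> = (\<Sum>j\<in>I. if j = i then p i * (\<integral>x. f (s i x) \<partial>\<mu>) else 0)"
  proof (intro sum.cong refl)
    fix j assume j: "j \<in> I"
    show "p j * (\<integral>x. ?f (s j x) \<partial>\<mu>) = (if j = i then p i * (\<integral>x. f (s i x) \<partial>\<mu>) else 0)"
    proof (cases "j = i")
      case True
      have "AE x in \<mu>. ?f (s i x) = f (s i x)" using AE_attractor by eventually_elim simp
      then have "(\<integral>x. ?f (s i x) \<partial>\<mu>) = (\<integral>x. f (s i x) \<partial>\<mu>)"
        using \<open>?f \<in> _\<close> f compose_s_measurable[OF i, of ?f] compose_s_measurable[OF i, of f]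
        by (intro integral_cong_AE) (simp_all add: measurable_\<mu>)
      with True show ?thesis by simp
    next
      case False
      have "AE x in \<mu>. ?f (s j x) = 0" using vimage_piece_null[OF j i False] by eventually_elim simp
      then have "(\<integral>x. ?f (s j x) \<partial>\<mu>) = 0" by (rule integral_eq_zero_AE)
      with False show ?thesis by simp
    qed
  qed
  also have "\<dots> = p i * (\<integral>x. f (s i x) \<partial>\<mu>)" using i finite_I by simp
  finally show ?thesis by (simp add: set_lebesgue_integral_def)
qed

text \<open>
  Under the hypothesis on the other pieces, the atom at \<open>\<eta>\<close> reproduces itself with the factor \<open>p k < 1\<close>.
\<close>

lemma fixed_point_null:
  assumes k: "k \<in> I" and "s k \<eta> = \<eta>" and "p k < 1"
    and other: "\<And>i. i \<in> I \<Longrightarrow> i \<noteq> k \<Longrightarrow> \<eta> \<notin> s i ` \<Gamma>"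
  shows "AE x in \<mu>. x \<noteq> \<eta>"
proof -
  have zero: "measure \<mu> (s i -` {\<eta>}) = 0" if "i \<in> I" "i \<noteq> k" for i
  proof -
    have "s i -` {\<eta>} \<subseteq> - \<Gamma>" using other[OF that] by auto
    then have "emeasure \<mu> (s i -` {\<eta>}) \<le> emeasure \<mu> (- \<Gamma>)"
      using attractor_borel by (intro emeasure_mono) (auto simp: sets_\<mu> borel_comp)
    then show ?thesis using supported by (simp add: measure_def)
  qed
  have "s k x = \<eta> \<longleftrightarrow> x = \<eta>" for x using \<open>s k \<eta> = \<eta>\<close> by (metis inv_s k)
  then have fixed: "s k -` {\<eta>} = {\<eta>}" by auto
  have "measure \<mu> {\<eta>} = p k * measure \<mu> (s k -` {\<eta>}) + (\<Sum>i\<in>I-{k}. p i * measure \<mu> (s i -` {\<eta>}))"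
    by (subst invariant) (simp_all add: sum.remove[OF finite_I k])
  also have "\<dots> = p k * measure \<mu> {\<eta>}" using zero by (simp add: fixed)
  finally have "measure \<mu> {\<eta>} = p k * measure \<mu> {\<eta>}" .
  then have "(1 - p k) * measure \<mu> {\<eta>} = 0" by algebra
  then have "emeasure \<mu> {\<eta>} = 0" using \<open>p k < 1\<close> by (simp add: emeasure_eq_measure)
  then show ?thesis by (intro AE_I[of _ _ "{\<eta>}"]) (auto simp: sets_\<mu>)
qed

section \<open>Integrals of functions that rescale affinely near a fixed point\<close>

text \<open>
  Truncation makes all integrals finite, so that the term with \<open>p k * a < 1\<close> may be moved to the left
  hand side; \<open>1 \<le> a\<close> ensures that the affine bound survives the truncation at height \<open>n\<close>, since then
  \<open>n \<le> a * n + b\<close>.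
\<close>

lemma integrable_of_affine_bound:
  fixes f :: "'a \<Rightarrow> real"
  assumes k: "k \<in> I" and f: "f \<in> borel_measurable borel" "\<And>x. 0 \<le> f x"
    and bound: "\<And>x. f (s k x) \<le> a * f x + b" and a: "1 \<le> a" and b: "0 \<le> b"
    and contr: "p k * a < 1"
    and other: "\<And>i x. i \<in> I \<Longrightarrow> i \<noteq> k \<Longrightarrow> x \<in> \<Gamma> \<Longrightarrow> f (s i x) \<le> C"
  shows "integrable \<mu> f"
proof -
  let ?g = "\<lambda>n x. min (f x) (real n)"
  have meas: "?g n \<in> borel_measurable borel" for n using f by simp
  have int: "integrable \<mu> (?g n)" for n
    by (rule integrable_const_bound[of _ "real n"]) (use f meas in \<open>auto simp: measurable_\<mu>\<close>)
  have ints: "integrable \<mu> (\<lambda>x. ?g n (s i x))" if "i \<in> I" for n i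
    using integrable_compose_s[OF that meas int] .
  define K where "K = p k * (b * measure \<mu> UNIV) + (\<Sum>i\<in>I-{k}. p i * (C * measure \<mu> UNIV))"
  have le: "(1 - p k * a) * (\<integral>x. ?g n x \<partial>\<mu>) \<le> K" for n
  proof -
    have "min (f (s k x)) (real n) \<le> a * min (f x) (real n) + b" for x
    proof (cases "f x \<le> real n")
      case False
      have "real n \<le> a * real n" using a by (simp add: mult_le_cancel_right1)
      with False b show ?thesis by auto
    qed (use bound[of x] in auto)
    then have "(\<integral>x. ?g n (s k x) \<partial>\<mu>) \<le> (\<integral>x. a * ?g n x + b \<partial>\<mu>)"
      using int ints[OF k] by (intro integral_mono) auto
    also have "\<dots> = a * (\<integral>x. ?g n x \<partial>\<mu>) + b * measure \<mu> UNIV"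
      using int[of n] by (simp add: space_\<mu> mult.commute)
    finally have 1: "p k * (\<integral>x. ?g n (s k x) \<partial>\<mu>)
        \<le> p k * (a * (\<integral>x. ?g n x \<partial>\<mu>) + b * measure \<mu> UNIV)"
      using weight_pos[OF k] by simp
    have 2: "p i * (\<integral>x. ?g n (s i x) \<partial>\<mu>) \<le> p i * (C * measure \<mu> UNIV)" if "i \<in> I - {k}" for i
    proof -
      have "AE x in \<mu>. ?g n (s i x) \<le> C"
        using AE_attractor by eventually_elim (use other that in fastforce)
      then have "(\<integral>x. ?g n (s i x) \<partial>\<mu>) \<le> (\<integral>x. C \<partial>\<mu>)"
        using ints[of i n] that by (intro integral_mono_AE) auto
      then show ?thesis using weight_pos[of i] that by (simp add: space_\<mu> mult.commute)
    qed
    have "(\<integral>x. ?g n x \<partial>\<mu>) = p k * (\<integral>x. ?g n (s k x) \<partial>\<mu>) + (\<Sum>i\<in>I-{k}. p i * (\<integral>x. ?g n (s i x) \<partial>\<mu>))"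
      using integral_invariant[OF meas int, of n] finite_I k by (simp add: sum.remove)
    also have "\<dots> \<le> p k * (a * (\<integral>x. ?g n x \<partial>\<mu>) + b * measure \<mu> UNIV) +
        (\<Sum>i\<in>I-{k}. p i * (C * measure \<mu> UNIV))"
      using 1 2 by (intro add_mono sum_mono) auto
    finally show ?thesis by (simp add: K_def algebra_simps)
  qed
  have inc: "incseq (\<lambda>n. \<integral>x. ?g n x \<partial>\<mu>)"
    by (intro incseq_SucI integral_mono int) auto
  have "(\<integral>x. ?g n x \<partial>\<mu>) \<le> K / (1 - p k * a)" for n
    using le[of n] contr by (simp add: field_simps)
  then obtain L where L: "(\<lambda>n. \<integral>x. ?g n x \<partial>\<mu>) \<longlonglongrightarrow> L"
    using incseq_convergent[OF inc] by blast
  show ?thesis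
  proof (rule integrable_monotone_convergence[OF int _ _ L])
    show "AE x in \<mu>. mono (\<lambda>n. ?g n x)" by (auto simp: mono_def)
    have "(\<lambda>n. ?g n x) \<longlonglongrightarrow> f x" for x
    proof (rule tendsto_eventually)
      obtain n0 where "f x \<le> real n0" using real_arch_simple by blast
      then show "\<forall>\<^sub>F n in sequentially. ?g n x = f x"
        by (intro eventually_sequentiallyI[of n0]) auto
    qed
    then show "AE x in \<mu>. (\<lambda>n. ?g n x) \<longlonglongrightarrow> f x" by simp
    show "f \<in> borel_measurable \<mu>" using f by (simp add: measurable_\<mu>)
  qed
qed

text \<open>
  The representation formula in abstract form: \<open>f \<circ> s k\<close> is expressed through \<open>f\<close> in the invariance
  relation, and the remaining terms are integrals over the other pieces.
\<close>

lemma integral_affine_rescaling: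
  fixes f :: "'a \<Rightarrow> real"
  assumes k: "k \<in> I" and f: "f \<in> borel_measurable borel" "integrable \<mu> f"
    and scale: "AE x in \<mu>. f (s k x) = a * f x + b"
  shows "(1 - p k * a) * (\<integral>x. f x \<partial>\<mu>) =
    p k * b * measure \<mu> \<Gamma> + (\<Sum>i\<in>I-{k}. LINT x:(s i ` \<Gamma>)|\<mu>. f x)"
proof -
  have "(\<integral>x. f (s k x) \<partial>\<mu>) = (\<integral>x. a * f x + b \<partial>\<mu>)"
    using scale f compose_s_measurable[OF k f(1)]
    by (intro integral_cong_AE) (auto simp: measurable_\<mu>)
  also have "\<dots> = a * (\<integral>x. f x \<partial>\<mu>) + b * measure \<mu> UNIV"
    using f by (simp add: space_\<mu> mult.commute)
  also have "measure \<mu> UNIV = measure \<mu> \<Gamma>"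
    using AE_attractor attractor_borel by (intro finite_measure_eq_AE) (auto simp: sets_\<mu>)
  finally have k_eq: "(\<integral>x. f (s k x) \<partial>\<mu>) = a * (\<integral>x. f x \<partial>\<mu>) + b * measure \<mu> \<Gamma>" .
  have "(\<integral>x. f x \<partial>\<mu>) = p k * (\<integral>x. f (s k x) \<partial>\<mu>) + (\<Sum>i\<in>I-{k}. p i * (\<integral>x. f (s i x) \<partial>\<mu>))"
    using integral_invariant[OF f] finite_I k by (simp add: sum.remove)
  also have "(\<Sum>i\<in>I-{k}. p i * (\<integral>x. f (s i x) \<partial>\<mu>)) = (\<Sum>i\<in>I-{k}. LINT x:(s i ` \<Gamma>)|\<mu>. f x)"
    using integral_piece f by (intro sum.cong) auto
  finally show ?thesis unfolding k_eq by algebra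
qed

lemma set_integral_attractor:
  fixes f :: "'a \<Rightarrow> real"
  assumes f: "f \<in> borel_measurable borel" "integrable \<mu> f"
  shows "set_integrable \<mu> \<Gamma> f" and "(LINT x:\<Gamma>|\<mu>. f x) = (\<integral>x. f x \<partial>\<mu>)"
proof -
  show "set_integrable \<mu> \<Gamma> f" unfolding set_integrable_def
    using f attractor_borel by (intro integrable_mult_indicator) (auto simp: sets_\<mu>)
  have "(\<lambda>x. indicator \<Gamma> x *\<^sub>R f x) \<in> borel_measurable borel"
    using f attractor_borel by measurable
  moreover have "AE x in \<mu>. indicator \<Gamma> x *\<^sub>R f x = f x"
    using AE_attractor by eventually_elim simp
  ultimately show "(LINT x:\<Gamma>|\<mu>. f x) = (\<integral>x. f x \<partial>\<mu>)"
    unfolding set_lebesgue_integral_def using f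
    by (intro integral_cong_AE) (auto simp: measurable_\<mu>)
qed

end

section \<open>The kernels at a fixed point\<close>

lemma Phi_measurable: "(\<lambda>x. Phi t x \<eta>) \<in> borel_measurable borel"
  unfolding Phi_def by (cases "t = 0") simp_all

lemma Phi_continuous: "\<eta> \<notin> K \<Longrightarrow> continuous_on K (\<lambda>x. Phi t x \<eta>)"
  unfolding Phi_def by (cases "t = 0") (auto intro!: continuous_intros)

lemma Phi_rescale:
  assumes "x \<noteq> \<eta>" and "0 < c" and "norm (y - \<eta>) = c * norm (x - \<eta>)"
  shows "Phi t y \<eta> = c powr (- t) * Phi t x \<eta> + (if t = 0 then ln c else 0)"
  using assms by (auto simp: Phi_def ln_mult powr_mult)

text \<open>
  In contrast to the exact law, the bound extends to \<open>x = \<eta>\<close>, where both values of the kernel are \<open>0\<close>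
  by the conventions for \<open>ln 0\<close> and \<open>0 powr a\<close>.
\<close>

lemma abs_Phi_rescale_le:
  assumes "0 < c" and "norm (y - \<eta>) = c * norm (x - \<eta>)"
  shows "\<bar>Phi t y \<eta>\<bar> \<le> c powr (- t) * \<bar>Phi t x \<eta>\<bar> + (if t = 0 then \<bar>ln c\<bar> else 0)"
proof (cases "x = \<eta>")
  case True
  then show ?thesis using assms by (auto simp: Phi_def)
next
  case False
  then show ?thesis using Phi_rescale[OF False assms, of t] assms(1)
    by (auto simp: abs_mult intro: order_trans[OF abs_triangle_ineq])
qed

lemma ifs_map_dist:
  assumes "0 < \<rho> i" and "orthogonal_matrix (A i)"
  shows "dist (ifs_map \<rho> A \<delta> i x) (ifs_map \<rho> A \<delta> i y) = \<rho> i * dist x y"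
proof -
  have "orthogonal_transformation ((*v) (A i))"
    using assms(2) by (simp add: orthogonal_transformation_matrix)
  then have "dist (A i *v x) (A i *v y) = dist x y"
    by (simp add: orthogonal_transformation_isometry)
  then show ?thesis using assms(1)
    by (simp add: ifs_map_def dist_norm scaleR_diff_right[symmetric])
qed

lemma ifs_map_surj:
  assumes "0 < \<rho> i" and "orthogonal_matrix (A i)"
  shows "surj (ifs_map \<rho> A \<delta> i)"
proof -
  have "surj ((*v) (A i))"
    using assms(2) by (intro orthogonal_transformation_surj) (simp add: orthogonal_transformation_matrix)
  then have "\<exists>x. A i *v x = (1 / \<rho> i) *\<^sub>R (y - \<delta> i)" for y by (metis surjD)
  then have "\<exists>x. y = ifs_map \<rho> A \<delta> i x" for y
    using assms(1) by (metis (no_types, lifting) ifs_map_def diff_add_cancel divide_self_if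
        less_irrefl scaleR_one scaleR_scaleR times_divide_eq_right mult.right_neutral)
  then show ?thesis by (auto simp: surj_def)
qed

theorem theorem4p3:
  fixes M m :: nat and \<rho> p :: "nat \<Rightarrow> real"
    and A :: "nat \<Rightarrow> real^'n^'n" and \<delta> :: "nat \<Rightarrow> real^'n"
    and s :: "nat \<Rightarrow> real^'n \<Rightarrow> real^'n"
    and \<Gamma> :: "(real^'n) set" and \<mu> :: "(real^'n) measure"
    and \<eta> :: "real^'n" and t tm :: real
  assumes "similarity_ifs M \<rho> A"
    and "s = ifs_map \<rho> A \<delta>"
    and "is_attractor M s \<Gamma>"
    and "open_set_condition M s"
    and "invariant_measure M s p \<Gamma> \<mu>"
    and "m \<in> {1..M}"
    and "\<eta> \<in> \<Gamma>" and "s m \<eta> = \<eta>"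
    and "\<forall>m'\<in>{1..M}. m' \<noteq> m \<longrightarrow> \<eta> \<notin> s m' ` \<Gamma>"
    and "tm = ln (p m) / ln (\<rho> m)"
    and "0 \<le> t" and "t < tm"
  shows "set_integrable \<mu> \<Gamma> (\<lambda>x. Phi t x \<eta>) \<and>
    (LINT x:\<Gamma>|\<mu>. Phi t x \<eta>) =
      (if t = 0
       then inverse (1 - p m) *
              (p m * measure \<mu> \<Gamma> * ln (\<rho> m)
               + (\<Sum>m'\<in>{1..M} - {m}. LINT x:(s m' ` \<Gamma>)|\<mu>. Phi t x \<eta>))
       else inverse (1 - p m * \<rho> m powr (- t)) *
              (\<Sum>m'\<in>{1..M} - {m}. LINT x:(s m' ` \<Gamma>)|\<mu>. Phi t x \<eta>))"
proof -
  have ratio: "0 < \<rho> i" "\<rho> i < 1" "orthogonal_matrix (A i)" if "i \<in> {1..M}" for i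
    using assms(1) that unfolding similarity_ifs_def by auto
  obtain U where U: "U \<noteq> {}" "bounded U" "open U" "(\<Union>i\<in>{1..M}. s i ` U) \<subseteq> U"
      "\<forall>i\<in>{1..M}. \<forall>j\<in>{1..M}. i \<noteq> j \<longrightarrow> s i ` U \<inter> s j ` U = {}"
    using assms(4) unfolding open_set_condition_def by blast
  have inv: "\<forall>i\<in>{1..M}. 0 < p i \<and> p i < 1" "sets \<mu> = sets borel" "finite_measure \<mu>"
      "emeasure \<mu> (- \<Gamma>) = 0" "(\<Sum>i=1..M. p i) = 1"
      "\<forall>B\<in>sets borel. measure \<mu> B = (\<Sum>i=1..M. p i * measure \<mu> (s i -` B))"
    using assms(5) unfolding invariant_measure_def by auto
  interpret fm: finite_measure \<mu> by (rule inv(3))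
  interpret self_similar_measure "{1..M}" s \<rho> \<Gamma> U \<mu> p
  proof unfold_locales
    show "dist (s i x) (s i y) = \<rho> i * dist x y" if "i \<in> {1..M}" for i x y
      using ifs_map_dist ratio[OF that] assms(2) by blast
    show "surj (s i)" if "i \<in> {1..M}" for i
      using ifs_map_surj ratio[OF that] assms(2) by blast
    show "s i ` U \<subseteq> U" if "i \<in> {1..M}" for i using U(4) that by blast
    show "s i ` U \<inter> s j ` U = {}" if "i \<in> {1..M}" "j \<in> {1..M}" "i \<noteq> j" for i j
      using U(5) that by blast
    show "\<Gamma> \<noteq> {}" "compact \<Gamma>" "\<Gamma> = (\<Union>i\<in>{1..M}. s i ` \<Gamma>)"
      using assms(3) unfolding is_attractor_def by auto
  qed (use ratio U inv in auto)
  define a where "a = \<rho> m powr (- t)"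
  define b where "b = (if t = 0 then ln (\<rho> m) else 0)"
  note m = assms(6)
  have dist_\<eta>: "norm (s m x - \<eta>) = \<rho> m * norm (x - \<eta>)" for x
    using dist_s[OF m, of x \<eta>] assms(8) by (simp add: dist_norm)
  have a_ge: "1 \<le> a"
    using ratio[OF m] assms(11) by (simp add: a_def powr_minus one_le_inverse_iff powr_le1)
  \<comment> \<open>Multiplication by \<open>ln (\<rho> m) < 0\<close> turns \<open>t < tm\<close> into \<open>ln (p m) < t * ln (\<rho> m)\<close>.\<close>
  have contr: "p m * a < 1"
  proof -
    have "ln (\<rho> m) < 0" using ratio[OF m] by simp
    then have "ln (p m) < t * ln (\<rho> m)"
      using mult_strict_right_mono_neg[OF assms(12), of "ln (\<rho> m)"] assms(10) by simp
    then have "p m < \<rho> m powr t"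
      using inv(1) m ratio[OF m] by (metis exp_less_cancel_iff exp_ln powr_def less_irrefl)
    then show ?thesis using ratio[OF m] by (simp add: a_def powr_minus field_simps)
  qed
  have \<eta>_other: "\<eta> \<notin> s i ` \<Gamma>" if "i \<in> {1..M}" "i \<noteq> m" for i
    using assms(9) that by blast
  have "\<exists>C. \<forall>i\<in>{1..M}-{m}. \<forall>x\<in>\<Gamma>. \<bar>Phi t (s i x) \<eta>\<bar> \<le> C"
  proof -
    let ?K = "\<Union>i\<in>{1..M}-{m}. s i ` \<Gamma>"
    have "compact ?K" using compact_piece by (intro compact_UN) auto
    then have "compact ((\<lambda>x. Phi t x \<eta>) ` ?K)"
      using \<eta>_other by (intro compact_continuous_image Phi_continuous) auto
    then show ?thesis using compact_imp_bounded bounded_iff[of "(\<lambda>x. Phi t x \<eta>) ` ?K"] by fastforce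
  qed
  then obtain C where C: "\<And>i x. i \<in> {1..M} \<Longrightarrow> i \<noteq> m \<Longrightarrow> x \<in> \<Gamma> \<Longrightarrow> \<bar>Phi t (s i x) \<eta>\<bar> \<le> C"
    by blast
  have "integrable \<mu> (\<lambda>x. \<bar>Phi t x \<eta>\<bar>)"
  proof (rule integrable_of_affine_bound[OF m _ _ _ a_ge _ contr, where b = "\<bar>b\<bar>" and C = C])
    show "\<bar>Phi t (s m x) \<eta>\<bar> \<le> a * \<bar>Phi t x \<eta>\<bar> + \<bar>b\<bar>" for x
      using abs_Phi_rescale_le[OF ratio(1)[OF m] dist_\<eta>, of t x]
      by (auto simp: a_def b_def split: if_splits)
    show "(\<lambda>x. \<bar>Phi t x \<eta>\<bar>) \<in> borel_measurable borel" using Phi_measurable by measurable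
  qed (use C in auto)
  then have int: "integrable \<mu> (\<lambda>x. Phi t x \<eta>)"
    using Phi_measurable[of t \<eta>] by (subst (asm) integrable_abs_iff) (auto simp: measurable_\<mu>)
  have "AE x in \<mu>. x \<noteq> \<eta>"
    using fixed_point_null[OF m assms(8)] inv(1) m \<eta>_other by blast
  then have "AE x in \<mu>. Phi t (s m x) \<eta> = a * Phi t x \<eta> + b"
    by eventually_elim
      (simp only: a_def b_def Phi_rescale[OF _ ratio(1)[OF m] dist_\<eta>, of _ t] not_False_eq_True)
  note eq = integral_affine_rescaling[OF m Phi_measurable int this]
  have "(\<integral>x. Phi t x \<eta> \<partial>\<mu>) = inverse (1 - p m * a) *
      (p m * b * measure \<mu> \<Gamma> + (\<Sum>i\<in>{1..M}-{m}. LINT x:(s i ` \<Gamma>)|\<mu>. Phi t x \<eta>))"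
    using contr by (subst eq[symmetric]) simp
  then show ?thesis
    using set_integral_attractor[OF Phi_measurable int] ratio[OF m]
    by (simp add: a_def b_def mult_ac)
qed

end
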